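(* Let $G$ be a graph and $v\in V(G)$. If $\gamma_{st}(G-v)=\gamma_{st}(G)$, then \[ \operatorname{st}_{\gamma_{st}}(G)\le \operatorname{st}_{\gamma_{st}}(G-v)+1 . \]
   Context: All graphs are finite, simple and undirected. For a graph $G=(V,E)$, a set $D\subseteq V$ is a strong dominating set if every vertex $v\in V\setminus D$ is adjacent to some $u\in D$ with $\deg(v)\le\deg(u)$ (degrees taken in $G$). The strong domination number $\gamma_{st}(G)$ is the minimum size of a strong dominating set; the graph with no vertices has $\gamma_{st}=0$. For $S\subseteq V$, $G-S$ is the graph obtained by deleting the vertices of $S$, and $G-v=G-\{v\}$. The stability of the strong domination number is $\operatorname{st}_{\gamma_{st}}(G)=\min\{|S| : S\subseteq V,\ \gamma_{st}(G-S)\ne\gamma_{st}(G)\}$ (the choice $S=V$ is allowed, so that $\operatorname{st}_{\gamma_{st}}(K_n)=n$). *)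

theory Defs
  imports "Graph_Theory.Graph_Theory"
begin

text \<open>
  A finite simple undirected graph is represented, as in the AFP entry \<open>Graph_Theory\<close>, by a finite
  symmetric digraph without loops and parallel arcs (locale \<^locale>\<open>graph\<close>): an edge \<open>uv\<close> is the
  pair of opposite arcs between \<open>u\<close> and \<open>v\<close>. The null graph is allowed. The degree of a vertex
  is its \<^const>\<open>out_degree\<close>, see \<open>out_degree_eq_card_neighbours\<close> below.
\<close>

definition delete_verts :: "('a, 'b) pre_digraph \<Rightarrow> 'a set \<Rightarrow> ('a, 'b) pre_digraph" where
  "delete_verts G S = G \<restriction> (verts G - S)"

definition strong_dominating_set :: "('a, 'b) pre_digraph \<Rightarrow> 'a set \<Rightarrow> bool" where
  "strong_dominating_set G D \<longleftrightarrow> D \<subseteq> verts G \<and>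
     (\<forall>v \<in> verts G - D. \<exists>u \<in> D. v \<rightarrow>\<^bsub>G\<^esub> u \<and> out_degree G v \<le> out_degree G u)"

definition strong_domination_number :: "('a, 'b) pre_digraph \<Rightarrow> nat" where
  "strong_domination_number G = Min {card D | D. strong_dominating_set G D}"

text \<open>
  For a graph with at least one vertex the set below is finite and nonempty, as it contains
  \<^term>\<open>card (verts G)\<close>. For the null graph it is empty and the value is unspecified.
\<close>
definition strong_domination_stability :: "('a, 'b) pre_digraph \<Rightarrow> nat" where
  "strong_domination_stability G =
     Min {card S | S. S \<subseteq> verts G \<and>
       strong_domination_number (delete_verts G S) \<noteq> strong_domination_number G}"


lemma (in graph) out_degree_eq_card_neighbours:
  "out_degree G v = card {u \<in> verts G. v \<rightarrow>\<^bsub>G\<^esub> u}"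
proof -
  have "bij_betw (head G) (out_arcs G v) {u \<in> verts G. v \<rightarrow>\<^bsub>G\<^esub> u}"
    unfolding bij_betw_def inj_on_def arcs_ends_conv
    using no_multi_arcs by (force simp: arc_to_ends_def)
  then show ?thesis unfolding out_degree_def by (rule bij_betw_same_card)
qed

lemma (in graph) graph_delete_verts: "graph (delete_verts G S)"
  unfolding delete_verts_def
proof (unfold_locales)
  show "symmetric (G \<restriction> (verts G - S))"
    using sym_arcs unfolding symmetric_conv by fastforce
qed (auto simp: no_loops no_multi_arcs arc_to_ends_def intro: no_multi_arcs)

lemma (in wf_digraph) delete_verts_singleton: "delete_verts G {v} = del_vert v"
  unfolding delete_verts_def induce_subgraph_def del_vert_def by auto

lemma strong_domination_number_null:
  assumes "verts G = {}"
  shows "strong_domination_number G = 0"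
proof -
  have "{card D | D. strong_dominating_set G D} = {0}"
    using assms by (auto simp: strong_dominating_set_def)
  then show ?thesis by (simp add: strong_domination_number_def)
qed

lemma (in fin_digraph) finite_strong_dominating_cards:
  "finite {card D | D. strong_dominating_set G D}"
  by (rule finite_subset[of _ "card ` Pow (verts G)"]) (auto simp: strong_dominating_set_def)

lemma (in fin_digraph) strong_domination_number_attained:
  "\<exists>D. strong_dominating_set G D \<and> card D = strong_domination_number G"
proof -
  have "strong_dominating_set G (verts G)"
    by (simp add: strong_dominating_set_def)
  then have "{card D | D. strong_dominating_set G D} \<noteq> {}" by blast
  from Min_in[OF finite_strong_dominating_cards this]
  show ?thesis unfolding strong_domination_number_def by fastforce
qed

lemma (in fin_digraph) strong_domination_number_le:
  "strong_dominating_set G D \<Longrightarrow> strong_domination_number G \<le> card D"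
  unfolding strong_domination_number_def
  by (rule Min_le[OF finite_strong_dominating_cards]) blast

lemma (in fin_digraph) strong_domination_number_pos:
  assumes "verts G \<noteq> {}"
  shows "0 < strong_domination_number G"
proof -
  obtain D where D: "strong_dominating_set G D" "card D = strong_domination_number G"
    using strong_domination_number_attained by blast
  then have "D \<subseteq> verts G" by (simp add: strong_dominating_set_def)
  then have "finite D" using finite_verts finite_subset by blast
  moreover have "D \<noteq> {}" using D(1) assms by (auto simp: strong_dominating_set_def)
  ultimately show ?thesis using D(2) card_gt_0_iff by metis
qed

lemma (in graph) strong_domination_stability_witness:
  assumes "verts G \<noteq> {}"
  shows "strong_domination_number (delete_verts G (verts G)) \<noteq> strong_domination_number G"
  using strong_domination_number_pos[OF assms]
    strong_domination_number_null[of "delete_verts G (verts G)"]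
  by (simp add: delete_verts_def)

lemma strong_domination_number_complete:
  assumes "K\<^bsub>n\<^esub> G" and "n > 0"
  shows "strong_domination_number G = 1"
proof -
  interpret graph G using assms by (simp add: complete_digraph_def)
  have adj: "v \<rightarrow>\<^bsub>G\<^esub> u \<longleftrightarrow> v \<in> verts G \<and> u \<in> verts G \<and> v \<noteq> u" for u v
    using assms by (simp add: complete_digraph_def)
  have deg: "out_degree G v = card (verts G) - 1" if "v \<in> verts G" for v
  proof -
    have "{u \<in> verts G. v \<rightarrow>\<^bsub>G\<^esub> u} = verts G - {v}" using that adj by auto
    then show ?thesis using that by (simp add: out_degree_eq_card_neighbours)
  qed
  have ne: "verts G \<noteq> {}" using assms by (auto simp: complete_digraph_def)
  then obtain x where "x \<in> verts G" by blast
  then have "strong_dominating_set G {x}"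
    by (auto simp: strong_dominating_set_def adj deg)
  from strong_domination_number_le[OF this] strong_domination_number_pos[OF ne]
  show ?thesis by simp
qed

lemma strong_domination_stability_complete:
  assumes "K\<^bsub>n\<^esub> G" and "n > 0"
  shows "strong_domination_stability G = n"
proof -
  interpret graph G using assms by (simp add: complete_digraph_def)
  have n: "card (verts G) = n" using assms by (simp add: complete_digraph_def)
  then have ne: "verts G \<noteq> {}" using assms by auto
  have "S = verts G" if S: "S \<subseteq> verts G"
    "strong_domination_number (delete_verts G S) \<noteq> strong_domination_number G" for S
  proof (rule ccontr)
    assume "S \<noteq> verts G"
    then have "card (verts G - S) > 0" using S by (auto simp: card_gt_0_iff)
    moreover have "arcs_ends (delete_verts G S) =
        {(u,v). (u,v) \<in> arcs_ends G \<and> u \<in> verts G - S \<and> v \<in> verts G - S}"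
      by (auto simp: delete_verts_def arcs_ends_conv)
    then have "K\<^bsub>card (verts G - S)\<^esub> (delete_verts G S)"
      using assms graph_delete_verts[of S]
      by (auto simp: complete_digraph_def delete_verts_def)
    ultimately show False
      using strong_domination_number_complete assms S(2) by metis
  qed
  then have "{card S | S. S \<subseteq> verts G \<and>
      strong_domination_number (delete_verts G S) \<noteq> strong_domination_number G} = {n}"
    using strong_domination_stability_witness[OF ne] n by blast
  then show ?thesis by (simp add: strong_domination_stability_def)
qed

end

theory Submission
  imports Defs
begin

text \<open>Let H = G - v and let S be a smallest vertex set of H whose deletion changes the strong
  domination number of H. Deleting v and then S is the same as deleting \<open>insert v S\<close>
  from G (\<open>delete_verts_delete_verts\<close>). Since G and H have equal strong domination
  numbers, this deletion also changes the number of G, so \<open>insert v S\<close>, of size at most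
  |S| + 1, bounds the stability of G from above.\<close>

lemma delete_verts_delete_verts:
  "delete_verts (delete_verts G S) T = delete_verts G (S \<union> T)"
  by (auto simp: delete_verts_def induce_subgraph_def)

lemma (in graph) finite_strong_domination_stability_cards:
  "finite {card S | S. S \<subseteq> verts G \<and>
     strong_domination_number (delete_verts G S) \<noteq> strong_domination_number G}"
  by (rule finite_subset[of _ "card ` Pow (verts G)"]) auto

lemma (in graph) strong_domination_stability_le:
  assumes "S \<subseteq> verts G"
    and "strong_domination_number (delete_verts G S) \<noteq> strong_domination_number G"
  shows "strong_domination_stability G \<le> card S"
  unfolding strong_domination_stability_def
  by (rule Min_le[OF finite_strong_domination_stability_cards]) (use assms in blast)

text \<open>Deleting all vertices always changes the number of a nonempty graph, so the minimum
  ranges over a nonempty finite set and is attained.\<close>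

lemma (in graph) strong_domination_stability_attained:
  assumes "verts G \<noteq> {}"
  obtains S where "S \<subseteq> verts G"
    and "strong_domination_number (delete_verts G S) \<noteq> strong_domination_number G"
    and "card S = strong_domination_stability G"
proof -
  have "{card S | S. S \<subseteq> verts G \<and>
      strong_domination_number (delete_verts G S) \<noteq> strong_domination_number G} \<noteq> {}"
    using strong_domination_stability_witness[OF assms] by blast
  from Min_in[OF finite_strong_domination_stability_cards this] show ?thesis
    unfolding strong_domination_stability_def[symmetric] using that by auto
qed

theorem theorem3p3:
  fixes G :: "('a, 'b) pre_digraph" and v :: 'a
  assumes "graph G"
    and "v \<in> verts G"
    and "strong_domination_number (delete_verts G {v}) = strong_domination_number G"
  shows "strong_domination_stability G \<le> strong_domination_stability (delete_verts G {v}) + 1"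
proof -
  interpret graph G by fact
  let ?H = "delete_verts G {v}"
  interpret H: graph ?H by (rule graph_delete_verts)
  \<comment> \<open>The stability of the null graph is unspecified, so \<open>?H\<close> must be
    nonempty. Otherwise its strong domination number would be 0, yet it equals the positive one of
    G.\<close>
  have "strong_domination_number G > 0"
    using strong_domination_number_pos assms(2) by blast
  then have "verts ?H \<noteq> {}"
    using strong_domination_number_null[of ?H] assms(3) by auto
  then obtain S where S: "S \<subseteq> verts ?H"
    "strong_domination_number (delete_verts ?H S) \<noteq> strong_domination_number ?H"
    "card S = strong_domination_stability ?H"
    by (rule H.strong_domination_stability_attained)
  have "insert v S \<subseteq> verts G"
    using S(1) assms(2) by (auto simp: delete_verts_def)
  \<comment> \<open>The equality hypothesis turns "differs from the number of \<open>?H\<close>"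
    into "differs from the number of G".\<close>
  moreover have "strong_domination_number (delete_verts G (insert v S)) \<noteq> strong_domination_number G"
    using S(2) assms(3) by (simp add: delete_verts_delete_verts)
  ultimately have "strong_domination_stability G \<le> card (insert v S)"
    by (rule strong_domination_stability_le)
  also have "\<dots> \<le> card S + 1"
    using card_insert_le_m1[of "card S + 1" S v] by simp
  finally show ?thesis by (simp add: S(3))
qed

end
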